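(* Let $(H,\bullet,1,\alpha)$ be a Hom-group. Define a ternary operation $\langle -,-,-\rangle:H\times H\times H\to H$ by \[ \langle a,b,c\rangle=a\bullet\bigl(\alpha^{-1}(b^{-1})\bullet\alpha^{-1}(c)\bigr). \] Then $(H,\langle -,-,-\rangle,\alpha)$ is a Hom-heap.
   Context: A Hom-group (always meaning regular Hom-group) $(H,\bullet,1,\alpha)$ is a set $H$ with a distinguished element $1\in H$ (the unit), a bijective map $\alpha:H\to H$ and a binary operation $\bullet:H\times H\to H$ such that: (i) $\alpha(a)\bullet(b\bullet c)=(a\bullet b)\bullet\alpha(c)$ for all $a,b,c$; (ii) $\alpha(a\bullet b)=\alpha(a)\bullet\alpha(b)$ for all $a,b$; (iii) $a\bullet 1=1\bullet a=\alpha(a)$ for all $a$; (iv) for every $a\in H$ there exists $a^{-1}\in H$ (the inverse of $a$) with $a\bullet a^{-1}=a^{-1}\bullet a=1$. A Hom-heap $(H,\langle -,-,-\rangle,\alpha)$ is a set $H$ with a bijective map $\alpha:H\to H$ and a ternary operation on $H$ such that for all $e,f,x,y,z\in H$: (i) $\langle x,x,y\rangle=\alpha(y)=\langle y,x,x\rangle$; (ii) $\langle \alpha(e),\alpha(f),\langle x,y,z\rangle\rangle=\langle\langle e,f,x\rangle,\alpha(y),\alpha(z)\rangle$; (iii) $\alpha\langle x,y,z\rangle=\langle\alpha(x),\alpha(y),\alpha(z)\rangle$. *)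

theory Defs
  imports Main
begin

locale hom_group =
  fixes H :: "'a set"
    and mult :: "'a \<Rightarrow> 'a \<Rightarrow> 'a"  (infixl "\<bullet>" 70)
    and unit :: 'a  ("\<one>")
    and \<alpha> :: "'a \<Rightarrow> 'a"
  assumes mult_closed: "\<lbrakk>a \<in> H; b \<in> H\<rbrakk> \<Longrightarrow> a \<bullet> b \<in> H"
    and unit_closed: "\<one> \<in> H"
    and alpha_bij: "bij_betw \<alpha> H H"
    and hom_assoc: "\<lbrakk>a \<in> H; b \<in> H; c \<in> H\<rbrakk> \<Longrightarrow> \<alpha> a \<bullet> (b \<bullet> c) = (a \<bullet> b) \<bullet> \<alpha> c"
    and alpha_mult: "\<lbrakk>a \<in> H; b \<in> H\<rbrakk> \<Longrightarrow> \<alpha> (a \<bullet> b) = \<alpha> a \<bullet> \<alpha> b"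
    and mult_unit: "a \<in> H \<Longrightarrow> a \<bullet> \<one> = \<alpha> a"
    and unit_mult: "a \<in> H \<Longrightarrow> \<one> \<bullet> a = \<alpha> a"
    and inverse_exists: "a \<in> H \<Longrightarrow> \<exists>b\<in>H. a \<bullet> b = \<one> \<and> b \<bullet> a = \<one>"
begin

lemma inverse_unique:
  assumes "a \<in> H" "b \<in> H" "c \<in> H" "b \<bullet> a = \<one>" "a \<bullet> c = \<one>"
  shows "b = c"
proof -
  have "\<alpha> (\<alpha> b) = \<alpha> b \<bullet> (a \<bullet> c)"
    using assms alpha_bij by (simp add: mult_unit bij_betwE)
  also have "\<dots> = (b \<bullet> a) \<bullet> \<alpha> c"
    by (rule hom_assoc[OF assms(2,1,3)])
  also have "\<dots> = \<alpha> (\<alpha> c)"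
    using assms alpha_bij by (simp add: unit_mult bij_betwE)
  finally show ?thesis
    using assms alpha_bij by (metis bij_betwE bij_betw_imp_inj_on inj_onD)
qed

lemma inverse_ex1: "a \<in> H \<Longrightarrow> \<exists>!b. b \<in> H \<and> a \<bullet> b = \<one> \<and> b \<bullet> a = \<one>"
  using inverse_exists inverse_unique by blast

definition inverse :: "'a \<Rightarrow> 'a"
  where "inverse a = (THE b. b \<in> H \<and> a \<bullet> b = \<one> \<and> b \<bullet> a = \<one>)"

definition alpha_inv :: "'a \<Rightarrow> 'a"
  where "alpha_inv = inv_into H \<alpha>"

definition heap_op :: "'a \<Rightarrow> 'a \<Rightarrow> 'a \<Rightarrow> 'a"
  where "heap_op a b c = a \<bullet> (alpha_inv (inverse b) \<bullet> alpha_inv c)"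

end

locale hom_heap =
  fixes H :: "'a set"
    and t :: "'a \<Rightarrow> 'a \<Rightarrow> 'a \<Rightarrow> 'a"
    and \<alpha> :: "'a \<Rightarrow> 'a"
  assumes t_closed: "\<lbrakk>x \<in> H; y \<in> H; z \<in> H\<rbrakk> \<Longrightarrow> t x y z \<in> H"
    and alpha_bij: "bij_betw \<alpha> H H"
    and t_left: "\<lbrakk>x \<in> H; y \<in> H\<rbrakk> \<Longrightarrow> t x x y = \<alpha> y"
    and t_right: "\<lbrakk>x \<in> H; y \<in> H\<rbrakk> \<Longrightarrow> t y x x = \<alpha> y"
    and t_hom_assoc: "\<lbrakk>e \<in> H; f \<in> H; x \<in> H; y \<in> H; z \<in> H\<rbrakk> \<Longrightarrow>
      t (\<alpha> e) (\<alpha> f) (t x y z) = t (t e f x) (\<alpha> y) (\<alpha> z)"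
    and alpha_t: "\<lbrakk>x \<in> H; y \<in> H; z \<in> H\<rbrakk> \<Longrightarrow> \<alpha> (t x y z) = t (\<alpha> x) (\<alpha> y) (\<alpha> z)"

end

theory Submission
  imports Defs
begin

text \<open>Untwisting the product to \<open>a \<cdot> b = \<alpha>\<^sup>-\<^sup>1 (a \<bullet> b)\<close> makes \<open>H\<close> an ordinary group with
  the same unit and inverses, of which \<open>\<alpha>\<close> is an automorphism. In this group the ternary
  operation is \<open>\<alpha> (a \<cdot> b\<^sup>-\<^sup>1 \<cdot> c)\<close>, so every axiom is an identity of groups with automorphism.\<close>

context hom_group
begin

definition untwist :: "'a \<Rightarrow> 'a \<Rightarrow> 'a"  (infixr "\<cdot>" 70)
  where "a \<cdot> b = alpha_inv (a \<bullet> b)"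

lemma alpha_closed [simp]: "a \<in> H \<Longrightarrow> \<alpha> a \<in> H"
  using alpha_bij by (rule bij_betwE[rule_format])

lemma alpha_inv_closed [simp]: "a \<in> H \<Longrightarrow> alpha_inv a \<in> H"
  unfolding alpha_inv_def using alpha_bij by (metis bij_betw_imp_surj_on inv_into_into)

lemma alpha_alpha_inv [simp]: "a \<in> H \<Longrightarrow> \<alpha> (alpha_inv a) = a"
  unfolding alpha_inv_def using alpha_bij by (rule bij_betw_inv_into_right)

lemma alpha_inv_alpha [simp]: "a \<in> H \<Longrightarrow> alpha_inv (\<alpha> a) = a"
  unfolding alpha_inv_def using alpha_bij by (rule bij_betw_inv_into_left)

lemma alpha_eq_iff: "\<lbrakk>a \<in> H; b \<in> H\<rbrakk> \<Longrightarrow> \<alpha> a = \<alpha> b \<longleftrightarrow> a = b"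
  using alpha_inv_alpha by metis

lemma untwist_closed [simp]: "\<lbrakk>a \<in> H; b \<in> H\<rbrakk> \<Longrightarrow> a \<cdot> b \<in> H"
  by (simp add: untwist_def mult_closed)

lemma mult_eq: "\<lbrakk>a \<in> H; b \<in> H\<rbrakk> \<Longrightarrow> a \<bullet> b = \<alpha> (a \<cdot> b)"
  by (simp add: untwist_def mult_closed)

text \<open>Since \<alpha> is multiplicative for \<open>\<bullet>\<close>, both sides reduce to
  \<open>a \<bullet> b\<close>.\<close>

lemma alpha_untwist [simp]: "\<lbrakk>a \<in> H; b \<in> H\<rbrakk> \<Longrightarrow> \<alpha> (a \<cdot> b) = \<alpha> a \<cdot> \<alpha> b"
  by (simp add: untwist_def mult_closed flip: alpha_mult)

text \<open>Written with \<open>\<cdot>\<close>, each side of \<open>hom_assoc\<close> is \<alpha>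
  applied twice to one of the two bracketings; injectivity of \<alpha> removes both
  applications.\<close>

lemma untwist_assoc:
  assumes "a \<in> H" "b \<in> H" "c \<in> H"
  shows "(a \<cdot> b) \<cdot> c = a \<cdot> b \<cdot> c"
proof -
  have "\<alpha> (\<alpha> (a \<cdot> b \<cdot> c)) = \<alpha> (\<alpha> ((a \<cdot> b) \<cdot> c))"
    using hom_assoc[OF assms] assms by (simp add: mult_eq)
  then show ?thesis
    using assms by (simp add: alpha_eq_iff del: alpha_untwist)
qed

lemma untwist_unit [simp]: "a \<in> H \<Longrightarrow> a \<cdot> \<one> = a"
  by (simp add: untwist_def mult_unit)

lemma unit_untwist [simp]: "a \<in> H \<Longrightarrow> \<one> \<cdot> a = a"
  by (simp add: untwist_def unit_mult)

lemma alpha_unit [simp]: "\<alpha> \<one> = \<one>"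
proof -
  \<comment> \<open>The preimage of the unit is inserted as a right factor because \<alpha> turns it
    into the unit.\<close>
  have "\<alpha> \<one> = \<alpha> \<one> \<cdot> \<alpha> (alpha_inv \<one>)"
    using unit_closed by simp
  also have "\<dots> = \<alpha> (\<one> \<cdot> alpha_inv \<one>)"
    using unit_closed by (simp del: unit_untwist)
  also have "\<dots> = \<one>"
    using unit_closed by (simp del: alpha_untwist)
  finally show ?thesis .
qed

lemma alpha_inv_unit [simp]: "alpha_inv \<one> = \<one>"
  using alpha_inv_alpha[OF unit_closed] by simp

lemma inverse_props:
  assumes "a \<in> H"
  shows "inverse a \<in> H \<and> a \<bullet> inverse a = \<one> \<and> inverse a \<bullet> a = \<one>"
  unfolding inverse_def using inverse_ex1[OF assms] by (rule theI')

lemma inverse_closed [simp]: "a \<in> H \<Longrightarrow> inverse a \<in> H"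
  by (simp add: inverse_props)

text \<open>Inverses for \<open>\<bullet>\<close> remain inverses for \<open>\<cdot>\<close> because
  \<open>alpha_inv\<close> fixes the unit.\<close>

lemma untwist_inverse [simp]: "a \<in> H \<Longrightarrow> a \<cdot> inverse a = \<one>"
  by (simp add: untwist_def inverse_props)

lemma inverse_untwist [simp]: "a \<in> H \<Longrightarrow> inverse a \<cdot> a = \<one>"
  by (simp add: untwist_def inverse_props)

text \<open>Cancels in right-nested products, the normal form under \<open>untwist_assoc\<close>, as
  \<open>t_left\<close> requires.\<close>

lemma untwist_inverse_cancel [simp]: "\<lbrakk>a \<in> H; b \<in> H\<rbrakk> \<Longrightarrow> a \<cdot> inverse a \<cdot> b = b"
  by (simp flip: untwist_assoc)

lemma inverse_alpha [simp]:
  assumes "a \<in> H"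
  shows "inverse (\<alpha> a) = \<alpha> (inverse a)"
proof (rule inverse_unique[of "\<alpha> a"])
  show "\<alpha> a \<bullet> \<alpha> (inverse a) = \<one>"
    using assms by (simp add: inverse_props flip: alpha_mult)
qed (use assms in \<open>simp_all add: inverse_props\<close>)

text \<open>The \<alpha> coming from the inner product distributes over its factors and cancels both
  occurrences of \<open>alpha_inv\<close>.\<close>

lemma heap_op_eq:
  assumes "a \<in> H" "b \<in> H" "c \<in> H"
  shows "heap_op a b c = \<alpha> (a \<cdot> inverse b \<cdot> c)"
  using assms by (simp add: heap_op_def mult_eq)

text \<open>In \<open>t_hom_assoc\<close> both sides become \<alpha> applied twice to the product of
  \<open>e\<close>, \<open>inverse f\<close>, \<open>x\<close>, \<open>inverse y\<close> and
  \<open>z\<close>.\<close>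

lemma hom_heap_heap_op: "hom_heap H heap_op \<alpha>"
  by unfold_locales (simp_all add: alpha_bij heap_op_eq untwist_assoc)

end

theorem theorem3p10:
  fixes H :: "'a set" and mult :: "'a \<Rightarrow> 'a \<Rightarrow> 'a" and unit :: 'a and \<alpha> :: "'a \<Rightarrow> 'a"
  assumes "hom_group H mult unit \<alpha>"
  shows "hom_heap H (hom_group.heap_op H mult unit \<alpha>) \<alpha>"
  using assms by (rule hom_group.hom_heap_heap_op)

end
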